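(* Let $S$ denote the circle of circumference $4$, with the arc-length metric. Then for any nonzero real normed vector space $V$, $\mathrm{map\text{-}rad}(S,V)=1$.
   Context: A map $f:X\to Y$ of metric spaces is nonexpansive if $d(f(x_0),f(x_1))\le d(x_0,x_1)$ for all $x_0,x_1\in X$; $\mathbf{Metr}(X,Y)$ denotes the set of nonexpansive maps $X\to Y$. For a nonempty subset $A$ of a metric space $Y$, $\mathrm{rad}_Y(A)=\inf_{y\in Y}\sup_{a\in A} d(a,y)\in[0,+\infty]$. For metric spaces $X,Y$, $\mathrm{map\text{-}rad}(X,Y)=\sup_{f\in\mathbf{Metr}(X,Y)}\mathrm{rad}_Y(f(X))$. Normed vector spaces are regarded as metric spaces via the metric induced by the norm. *)

theory Defs
  imports "HOL-Analysis.Analysis"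
begin

definition Metr :: "'a metric \<Rightarrow> 'b metric \<Rightarrow> ('a \<Rightarrow> 'b) set" where
  "Metr X Y = {f \<in> mspace X \<rightarrow>\<^sub>E mspace Y.
     \<forall>x\<^sub>0\<in>mspace X. \<forall>x\<^sub>1\<in>mspace X. mdist Y (f x\<^sub>0) (f x\<^sub>1) \<le> mdist X x\<^sub>0 x\<^sub>1}"

(* Infima and suprema are taken in ennreal, i.e. in [0, \<infinity>]; only meant for nonempty A. *)
definition rad :: "'a metric \<Rightarrow> 'a set \<Rightarrow> ennreal" where
  "rad Y A = (INF y\<in>mspace Y. SUP a\<in>A. ennreal (mdist Y a y))"

definition map_rad :: "'a metric \<Rightarrow> 'b metric \<Rightarrow> ennreal" where
  "map_rad X Y = (SUP f\<in>Metr X Y. rad Y (f ` mspace X))"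

(* The circle of circumference c is the circle of radius c / (2 * pi) about 0 in the complex
   plane. If z = w * cis t, then turning w through the (signed) angle t traces an arc from w to z
   of length radius * \<bar>t\<bar>, and every arc from w to z arises in this way; the arc-length distance
   is the infimum of these lengths. Off the circle the distance is set to 0, because the distance
   function of a metric has to be total, nonnegative and symmetric. *)
definition circle :: "real \<Rightarrow> complex set" where
  "circle c = sphere 0 (c / (2 * pi))"

definition arc_dist :: "real \<Rightarrow> complex \<Rightarrow> complex \<Rightarrow> real" where
  "arc_dist c w z = (if w \<in> circle c \<and> z \<in> circle c
     then INF t\<in>{t. z = w * cis t}. c / (2 * pi) * \<bar>t\<bar> else 0)"

definition circle_metric :: "real \<Rightarrow> complex metric" where
  "circle_metric c = metric (circle c, arc_dist c)"

lemma circle_radius_nonneg: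
  assumes "w \<in> circle c" shows "0 \<le> c / (2 * pi)"
proof -
  have "norm w = c / (2 * pi)"
    using assms by (simp add: circle_def)
  then show ?thesis
    by (metis norm_ge_zero)
qed

lemma circle_rotation:
  assumes "w \<in> circle c" "z \<in> circle c" shows "\<exists>t. z = w * cis t"
proof -
  have n: "norm w = c / (2 * pi)" "norm z = c / (2 * pi)"
    using assms by (simp_all add: circle_def)
  show ?thesis
  proof (cases "w = 0")
    case True
    then have "z = 0" using n by (metis norm_eq_zero)
    then show ?thesis using True by simp
  next
    case False
    have "norm (z / w) = 1"
      using n False by (metis norm_divide divide_self_if norm_eq_zero)
    then obtain t where "z / w = cis t"
      by (metis complex_norm_eq_1_exp_eq cis_conv_exp)
    then show ?thesis using False by (metis nonzero_mult_div_cancel_left times_divide_eq_right)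
  qed
qed

lemma arc_dist_le:
  assumes "w \<in> circle c" "w * cis t \<in> circle c"
  shows "arc_dist c w (w * cis t) \<le> c / (2 * pi) * \<bar>t\<bar>"
proof -
  have "0 \<le> c / (2 * pi) * \<bar>s\<bar>" for s
    using circle_radius_nonneg[OF assms(1)] by (rule mult_nonneg_nonneg) simp
  then have "bdd_below ((\<lambda>t. c / (2 * pi) * \<bar>t\<bar>) ` A)" for A
    by (intro bdd_belowI2[where m=0])
  then show ?thesis
    unfolding arc_dist_def using assms by (auto intro: cINF_lower)
qed

lemma arc_dist_greatest:
  assumes "w \<in> circle c" "z \<in> circle c"
    and "\<And>t. z = w * cis t \<Longrightarrow> b \<le> c / (2 * pi) * \<bar>t\<bar>"
  shows "b \<le> arc_dist c w z"
  unfolding arc_dist_def using assms circle_rotation[OF assms(1,2)]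
  by (auto intro!: cINF_greatest)

lemma dist_le_arc_dist:
  assumes "w \<in> circle c" "z \<in> circle c" shows "dist w z \<le> arc_dist c w z"
proof (rule arc_dist_greatest[OF assms])
  fix t assume z: "z = w * cis t"
  have "norm (cis t - 1) = 2 * \<bar>sin (t / 2)\<bar>"
    using dist_exp_i_1[of t] by (simp add: cis_conv_exp)
  also have "\<dots> \<le> \<bar>t\<bar>"
    using abs_sin_x_le_abs_x[of "t / 2"] by simp
  finally have "norm w * norm (cis t - 1) \<le> norm w * \<bar>t\<bar>"
    by (rule mult_left_mono) simp
  moreover have "dist w z = norm w * norm (cis t - 1)"
    by (simp add: z dist_norm norm_minus_commute right_diff_distrib flip: norm_mult)
  ultimately show "dist w z \<le> c / (2 * pi) * \<bar>t\<bar>"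
    using assms(1) by (simp add: circle_def)
qed

lemma arc_dist_commute: "arc_dist c w z = arc_dist c z w"
proof -
  have *: "arc_dist c w z \<le> arc_dist c z w" if "w \<in> circle c" "z \<in> circle c" for w z
  proof (rule arc_dist_greatest[OF that(2,1)])
    fix t assume "w = z * cis t"
    then have "z = w * cis (- t)" by (simp add: mult.assoc cis_mult)
    then show "arc_dist c w z \<le> c / (2 * pi) * \<bar>t\<bar>"
      using arc_dist_le[of w c "- t"] that by simp
  qed
  show ?thesis
  proof (cases "w \<in> circle c \<and> z \<in> circle c")
    case True
    then show ?thesis using *[of w z] *[of z w] by simp
  qed (auto simp: arc_dist_def)
qed

lemma arc_dist_triangle:
  assumes "x \<in> circle c" "y \<in> circle c" "z \<in> circle c"
  shows "arc_dist c x z \<le> arc_dist c x y + arc_dist c y z"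
proof -
  have "arc_dist c x z - arc_dist c y z \<le> arc_dist c x y"
  proof (rule arc_dist_greatest[OF assms(1,2)])
    fix s assume y: "y = x * cis s"
    have "arc_dist c x z - c / (2 * pi) * \<bar>s\<bar> \<le> arc_dist c y z"
    proof (rule arc_dist_greatest[OF assms(2,3)])
      fix t assume "z = y * cis t"
      then have z: "z = x * cis (s + t)" by (simp add: y mult.assoc cis_mult)
      have "arc_dist c x z \<le> c / (2 * pi) * \<bar>s + t\<bar>"
        using arc_dist_le[of x c "s + t"] assms z by simp
      also have "\<dots> \<le> c / (2 * pi) * (\<bar>s\<bar> + \<bar>t\<bar>)"
        using circle_radius_nonneg[OF assms(1)] by (intro mult_left_mono) auto
      finally show "arc_dist c x z - c / (2 * pi) * \<bar>s\<bar> \<le> c / (2 * pi) * \<bar>t\<bar>"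
        by (simp only: distrib_left)
    qed
    then show "arc_dist c x z - arc_dist c y z \<le> c / (2 * pi) * \<bar>s\<bar>" by linarith
  qed
  then show ?thesis by linarith
qed

lemma Metric_space_circle: "Metric_space (circle c) (arc_dist c)"
proof
  fix x y :: complex
  show "0 \<le> arc_dist c x y"
  proof (cases "x \<in> circle c \<and> y \<in> circle c")
    case True
    then show ?thesis using dist_le_arc_dist[of x c y] zero_le_dist[of x y] by linarith
  qed (auto simp: arc_dist_def)
  show "arc_dist c x y = arc_dist c y x" by (rule arc_dist_commute)
next
  fix x y assume xy: "x \<in> circle c" "y \<in> circle c"
  show "arc_dist c x y = 0 \<longleftrightarrow> x = y"
  proof
    assume "arc_dist c x y = 0"
    then show "x = y" using dist_le_arc_dist[OF xy] by simp
  next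
    assume "x = y"
    then show "arc_dist c x y = 0"
      using dist_le_arc_dist[OF xy] arc_dist_le[of x c 0] xy by simp
  qed
qed (rule arc_dist_triangle)

lemma mspace_circle_metric [simp]: "mspace (circle_metric c) = circle c"
  unfolding circle_metric_def by (rule Metric_space.mspace_metric[OF Metric_space_circle])

lemma mdist_circle_metric [simp]: "mdist (circle_metric c) = arc_dist c"
  unfolding circle_metric_def by (rule Metric_space.mdist_metric[OF Metric_space_circle])

end

theory Submission
  imports Defs
begin

text \<open>
  For every point \<open>z\<close> of the circle the distances to two antipodal points \<open>x\<close> and \<open>-x\<close> add up to
  at most half the circumference. Hence, for nonexpansive \<open>f\<close> on the circle of circumference 4, the
  midpoint of \<open>f x\<close> and \<open>f (-x)\<close> has distance at most 1 from the whole image. Conversely, for a unit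
  vector \<open>u\<close> the map sending \<open>z\<close> to \<open>d(x, z) u\<close> is nonexpansive, and its image contains the points
  0 and \<open>2 u\<close> at distance 2, so the bound 1 is attained.
\<close>

lemma uminus_in_circle [simp]: "- x \<in> circle c \<longleftrightarrow> x \<in> circle c"
  by (simp add: circle_def)

text \<open>Turning from \<open>x\<close> to \<open>z\<close> through \<open>t\<close> and from
  \<open>- x\<close> to \<open>z\<close> through \<open>s\<close> are two arcs that together make up
  a half circle, since \<bar>s\<bar> + \<bar>t\<bar> = pi.\<close>

lemma arc_dist_antipodal_sum_le:
  assumes "c > 0" "x \<in> circle c" "z \<in> circle c"
  shows "arc_dist c x z + arc_dist c (- x) z \<le> c / 2"
proof -
  have n: "norm x = c / (2 * pi)" "norm z = c / (2 * pi)"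
    using assms by (simp_all add: circle_def)
  then have nz: "x \<noteq> 0" "z \<noteq> 0" using assms(1) by auto
  define t where "t = Arg (z / x)"
  \<comment> \<open>Passing from \<open>x\<close> to \<open>- x\<close> shifts the angle by pi; the
    sign of the shift is chosen so that \<bar>s\<bar> \<le> pi.\<close>
  define s where "s = (if t \<le> 0 then t + pi else t - pi)"
  have t: "- pi < t" "t \<le> pi"
    unfolding t_def by (rule mpi_less_Arg, rule Arg_le_pi)
  have "cis t = sgn (z / x)"
    unfolding t_def using nz by (intro cis_Arg) simp
  also have "\<dots> = z / x"
    using n nz assms(1) by (simp add: sgn_div_norm norm_divide)
  finally have z: "z = x * cis t"
    using nz by simp
  have "cis s = - cis t"
    by (simp add: s_def cis.ctr complex_eq_iff)
  then have z': "z = - x * cis s"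
    using z by simp
  have "arc_dist c x z \<le> c / (2 * pi) * \<bar>t\<bar>"
    using arc_dist_le[of x c t] assms z by simp
  moreover have "arc_dist c (- x) z \<le> c / (2 * pi) * \<bar>s\<bar>"
    using arc_dist_le[of "- x" c s] assms z' by simp
  moreover have "\<bar>s\<bar> = pi - \<bar>t\<bar>"
    using t by (auto simp: s_def)
  ultimately have "arc_dist c x z + arc_dist c (- x) z
      \<le> c / (2 * pi) * \<bar>t\<bar> + c / (2 * pi) * (pi - \<bar>t\<bar>)"
    by simp
  also have "\<dots> = c / 2"
    by (simp add: field_simps)
  finally show ?thesis .
qed

text \<open>Every turn from \<open>x\<close> to \<open>- x\<close> has cosine -1, and cosine exceeds
  -1 on [0, pi), so the turn is through at least pi.\<close>

lemma arc_dist_antipodal_ge: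
  assumes "c > 0" "x \<in> circle c"
  shows "c / 2 \<le> arc_dist c x (- x)"
proof (rule arc_dist_greatest)
  fix t assume "- x = x * cis t"
  moreover have "x \<noteq> 0"
    using assms by (auto simp: circle_def)
  ultimately have "cis t = - 1"
    by (metis mult_cancel_left mult_minus1_right)
  then have cos: "cos \<bar>t\<bar> = - 1"
    by (simp add: complex_eq_iff)
  have "pi \<le> \<bar>t\<bar>"
  proof (rule ccontr)
    assume "\<not> pi \<le> \<bar>t\<bar>"
    then have "cos pi < cos \<bar>t\<bar>"
      by (intro cos_monotone_0_pi) auto
    then show False using cos by simp
  qed
  then have "c / (2 * pi) * pi \<le> c / (2 * pi) * \<bar>t\<bar>"
    using assms(1) by (intro mult_left_mono) auto
  then show "c / 2 \<le> c / (2 * pi) * \<bar>t\<bar>"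
    by simp
qed (use assms in auto)

lemma rad_le_of_subset_mcball:
  assumes "y \<in> mspace Y" "\<And>a. a \<in> A \<Longrightarrow> mdist Y a y \<le> r"
  shows "rad Y A \<le> ennreal r"
  unfolding rad_def using assms by (intro INF_lower2[of y] SUP_least ennreal_leI) auto

text \<open>By the triangle inequality, no centre \<open>y\<close> can be closer than half of
  \<open>mdist Y a b\<close> to both \<open>a\<close> and \<open>b\<close>.\<close>

lemma rad_ge_half_dist:
  assumes "a \<in> A" "b \<in> A" "a \<in> mspace Y" "b \<in> mspace Y"
  shows "ennreal (mdist Y a b / 2) \<le> rad Y A"
  unfolding rad_def
proof (rule INF_greatest)
  fix y assume y: "y \<in> mspace Y"
  have "mdist Y a b \<le> mdist Y a y + mdist Y b y"
    using mdist_triangle[OF assms(3) y assms(4)] by (simp add: mdist_commute)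
  then have "mdist Y a b / 2 \<le> mdist Y a y \<or> mdist Y a b / 2 \<le> mdist Y b y"
    by linarith
  then show "ennreal (mdist Y a b / 2) \<le> (SUP a\<in>A. ennreal (mdist Y a y))"
    using assms(1,2) by (auto intro: SUP_upper2 ennreal_leI)
qed

lemma map_rad_circle_le:
  assumes "c > 0"
  shows "map_rad (circle_metric c) (euclidean_metric :: 'v::real_normed_vector metric)
    \<le> ennreal (c / 4)"
  unfolding map_rad_def
proof (rule SUP_least)
  fix f :: "complex \<Rightarrow> 'v"
  assume "f \<in> Metr (circle_metric c) euclidean_metric"
  then have f: "dist (f w) (f z) \<le> arc_dist c w z" if "w \<in> circle c" "z \<in> circle c" for w z
    using that by (auto simp: Metr_def)
  define x where "x = complex_of_real (c / (2 * pi))"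
  have x: "x \<in> circle c"
    using assms by (simp add: circle_def x_def norm_divide norm_mult)
  have "dist (f z) (midpoint (f x) (f (- x))) \<le> c / 4" if z: "z \<in> circle c" for z
  proof -
    \<comment> \<open>The displacement from the midpoint is the average of the displacements from
      the two ends, so its norm is at most half the antipodal sum.\<close>
    have "f z - midpoint (f x) (f (- x)) = (1 / 2) *\<^sub>R ((f z - f x) + (f z - f (- x)))"
      by (simp add: midpoint_def algebra_simps flip: scaleR_add_left)
    then have "dist (f z) (midpoint (f x) (f (- x))) = norm ((f z - f x) + (f z - f (- x))) / 2"
      by (simp add: dist_norm)
    also have "\<dots> \<le> (dist (f x) (f z) + dist (f (- x)) (f z)) / 2"
      using norm_triangle_ineq[of "f z - f x" "f z - f (- x)"]
      by (simp add: dist_norm norm_minus_commute)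
    also have "\<dots> \<le> (arc_dist c x z + arc_dist c (- x) z) / 2"
      using f[of x z] f[of "- x" z] x z by simp
    also have "\<dots> \<le> c / 4"
      using arc_dist_antipodal_sum_le[OF assms x z] by simp
    finally show ?thesis .
  qed
  then show "rad euclidean_metric (f ` mspace (circle_metric c)) \<le> ennreal (c / 4)"
    by (intro rad_le_of_subset_mcball[where y = "midpoint (f x) (f (- x))"]) auto
qed

lemma map_rad_circle_ge:
  fixes v :: "'v::real_normed_vector"
  assumes "c > 0" "v \<noteq> 0"
  shows "ennreal (c / 4) \<le> map_rad (circle_metric c) (euclidean_metric :: 'v metric)"
proof -
  define x where "x = complex_of_real (c / (2 * pi))"
  have x: "x \<in> circle c"
    using assms by (simp add: circle_def x_def norm_divide norm_mult)
  \<comment> \<open>Scaling the unit vector \<open>sgn v\<close> embeds the real line isometrically,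
    so \<open>f\<close> inherits nonexpansiveness from the distance to \<open>x\<close>. The
    restriction is there because \<open>Metr\<close> consists of extensional functions.\<close>
  define f where "f = restrict (\<lambda>z. arc_dist c x z *\<^sub>R sgn v) (circle c)"
  have dist_f: "dist (f w) (f z) = \<bar>arc_dist c x w - arc_dist c x z\<bar>"
    if "w \<in> circle c" "z \<in> circle c" for w z
    using that assms(2) by (simp add: f_def dist_norm norm_sgn flip: scaleR_left_diff_distrib)
  have "f \<in> Metr (circle_metric c) euclidean_metric"
  proof -
    have "\<bar>arc_dist c x w - arc_dist c x z\<bar> \<le> arc_dist c w z"
      if "w \<in> circle c" "z \<in> circle c" for w z
      using arc_dist_triangle[OF x that] arc_dist_triangle[OF x that(2,1)] arc_dist_commute[of c w z]
      by linarith
    then show ?thesis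
      by (auto simp: Metr_def dist_f) (simp add: f_def)
  qed
  then have "rad euclidean_metric (f ` circle c)
      \<le> map_rad (circle_metric c) (euclidean_metric :: 'v metric)"
    unfolding map_rad_def by (metis SUP_upper mspace_circle_metric)
  moreover have "ennreal (dist (f x) (f (- x)) / 2) \<le> rad euclidean_metric (f ` circle c)"
    using rad_ge_half_dist[of "f x" "f ` circle c" "f (- x)" euclidean_metric] x by simp
  moreover have "c / 4 \<le> dist (f x) (f (- x)) / 2"
  proof -
    have "arc_dist c x x = 0"
      using Metric_space.zero[OF Metric_space_circle x x] by simp
    then show ?thesis
      using arc_dist_antipodal_ge[OF assms(1) x] x by (simp add: dist_f)
  qed
  ultimately show ?thesis
    by (meson ennreal_leI order_trans)
qed

theorem lemma2:
  assumes "\<exists>v :: 'v::real_normed_vector. v \<noteq> 0"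
  shows "map_rad (circle_metric 4) (euclidean_metric :: 'v metric) = 1"
proof -
  obtain v :: 'v where "v \<noteq> 0"
    using assms by blast
  then show ?thesis
    \<comment> \<open>Both bounds are c / 4, which is 1 for circumference 4.\<close>
    using map_rad_circle_le[of 4, where 'v = 'v] map_rad_circle_ge[of 4 v]
    by (intro antisym) auto
qed

end
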